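(* Let $\mathbb{K}$ be $\mathbb{R}$, $\mathbb{C}$, or the quaternions $\mathbb{H}$, and let $\mathcal{D}_U^L,\mathcal{D}_U^R$ be left and right general-diagonal scale functions on the set of $m\times n$ matrices over $\mathbb{K}$ with no element equal to zero. For an $m\times n$ matrix $A$ with no element equal to zero, define $$A^{-U}:=\mathcal{D}_U^R[A]\cdot\left(\mathcal{D}_U^L[A]\cdot A\cdot\mathcal{D}_U^R[A]\right)^{+}\cdot\mathcal{D}_U^L[A],$$ where $(\cdot)^{+}$ is the Moore-Penrose inverse. Then for every such $A$ and all nonsingular diagonal matrices $D$ ($m\times m$) and $E$ ($n\times n$) over $\mathbb{K}$: $$A\,A^{-U}A=A,\qquad A^{-U}A\,A^{-U}=A^{-U},\qquad (DAE)^{-U}=E^{-1}A^{-U}D^{-1},\qquad \operatorname{rank}[A^{-U}]=\operatorname{rank}[A].$$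
   Context: A positive diagonal matrix is a diagonal matrix whose diagonal entries are strictly positive reals. A unitary diagonal matrix is a diagonal matrix over $\mathbb{K}$ whose diagonal entries have magnitude $1$. Left and right general-diagonal scale functions on a class of $m\times n$ matrices (here: those with no zero element) are functions assigning to each $A$ in the class an $m\times m$ positive diagonal matrix $\mathcal{D}_U^L[A]$ and an $n\times n$ positive diagonal matrix $\mathcal{D}_U^R[A]$ that jointly satisfy, for all conformant positive diagonal matrices $D_+,E_+$, unitary diagonal matrices $D_u,D_v$, and permutation matrices $P,Q$: (1) $\mathcal{D}_U^L[D_+AE_+]\cdot(D_+AE_+)\cdot\mathcal{D}_U^R[D_+AE_+]=\mathcal{D}_U^L[A]\cdot A\cdot\mathcal{D}_U^R[A]$; (2) $\mathcal{D}_U^L[PAQ]\cdot(PAQ)\cdot\mathcal{D}_U^R[PAQ]=P\cdot\{\mathcal{D}_U^L[A]\cdot A\cdot\mathcal{D}_U^R[A]\}\cdot Q$; (3) $\mathcal{D}_U^L[D_uAD_v]=\mathcal{D}_U^L[A]$; (4) $\mathcal{D}_U^R[D_uAD_v]=\mathcal{D}_U^R[A]$. *)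

theory Defs
  imports "HOL-Analysis.Analysis"
begin

section \<open>The quaternions as a real normed division algebra\<close>

codatatype quat = Quat (qRe: real) (qI: real) (qJ: real) (qK: real)

lemma quat_eq_iff: "x = y \<longleftrightarrow> qRe x = qRe y \<and> qI x = qI y \<and> qJ x = qJ y \<and> qK x = qK y"
  by (metis quat.expand)

instantiation quat :: ab_group_add
begin

primcorec zero_quat where
  "qRe 0 = 0" | "qI 0 = 0" | "qJ 0 = 0" | "qK 0 = 0"

primcorec plus_quat where
  "qRe (x + y) = qRe x + qRe y"
| "qI (x + y) = qI x + qI y"
| "qJ (x + y) = qJ x + qJ y"
| "qK (x + y) = qK x + qK y"

primcorec uminus_quat where
  "qRe (- x) = - qRe x"
| "qI (- x) = - qI x"
| "qJ (- x) = - qJ x"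
| "qK (- x) = - qK x"

primcorec minus_quat where
  "qRe (x - y) = qRe x - qRe y"
| "qI (x - y) = qI x - qI y"
| "qJ (x - y) = qJ x - qJ y"
| "qK (x - y) = qK x - qK y"

instance
  by standard (simp_all add: quat_eq_iff)

end

definition quat_normsq :: "quat \<Rightarrow> real" where
  "quat_normsq x = (qRe x)\<^sup>2 + (qI x)\<^sup>2 + (qJ x)\<^sup>2 + (qK x)\<^sup>2"

lemma quat_normsq_nonneg: "0 \<le> quat_normsq x"
  by (simp add: quat_normsq_def)

lemma quat_normsq_eq_0_iff: "quat_normsq x = 0 \<longleftrightarrow> x = 0"
proof
  assume "quat_normsq x = 0"
  then have "(qRe x)\<^sup>2 = 0 \<and> (qI x)\<^sup>2 = 0 \<and> (qJ x)\<^sup>2 = 0 \<and> (qK x)\<^sup>2 = 0"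
    unfolding quat_normsq_def
    using zero_le_power2[of "qRe x"] zero_le_power2[of "qI x"]
      zero_le_power2[of "qJ x"] zero_le_power2[of "qK x"]
    by linarith
  then show "x = 0"
    by (simp add: quat_eq_iff)
qed (simp add: quat_normsq_def)

instantiation quat :: division_ring
begin

primcorec one_quat where
  "qRe 1 = 1" | "qI 1 = 0" | "qJ 1 = 0" | "qK 1 = 0"

primcorec times_quat where
  "qRe (x * y) = qRe x * qRe y - qI x * qI y - qJ x * qJ y - qK x * qK y"
| "qI (x * y) = qRe x * qI y + qI x * qRe y + qJ x * qK y - qK x * qJ y"
| "qJ (x * y) = qRe x * qJ y - qI x * qK y + qJ x * qRe y + qK x * qI y"
| "qK (x * y) = qRe x * qK y + qI x * qJ y - qJ x * qI y + qK x * qRe y"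

primcorec inverse_quat where
  "qRe (inverse x) = qRe x / quat_normsq x"
| "qI (inverse x) = - (qI x / quat_normsq x)"
| "qJ (inverse x) = - (qJ x / quat_normsq x)"
| "qK (inverse x) = - (qK x / quat_normsq x)"

definition divide_quat :: "quat \<Rightarrow> quat \<Rightarrow> quat" where
  "divide_quat x y = x * inverse y"

instance
proof
  fix x y z :: quat
  show "x * y * z = x * (y * z)" "(x + y) * z = x * z + y * z" "x * (y + z) = x * y + x * z"
    by (simp_all add: quat_eq_iff algebra_simps)
  show "1 * x = x" "x * 1 = x" "(0::quat) \<noteq> 1"
    by (simp_all add: quat_eq_iff)
  show "inverse (0::quat) = 0"
    by (simp add: quat_eq_iff)
  show "x div y = x * inverse y"
    by (rule divide_quat_def)
  assume "x \<noteq> 0"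
  then have nz: "quat_normsq x \<noteq> 0"
    by (simp add: quat_normsq_eq_0_iff)
  show "inverse x * x = 1" "x * inverse x = 1"
    using nz
    by (simp_all add: quat_eq_iff field_simps) (simp_all add: quat_normsq_def power2_eq_square)
qed

end

instantiation quat :: real_div_algebra
begin

primcorec scaleR_quat where
  "qRe (scaleR r x) = r * qRe x"
| "qI (scaleR r x) = r * qI x"
| "qJ (scaleR r x) = r * qJ x"
| "qK (scaleR r x) = r * qK x"

instance
proof
  fix r s :: real and x y :: quat
  show "r *\<^sub>R (x + y) = r *\<^sub>R x + r *\<^sub>R y" "(r + s) *\<^sub>R x = r *\<^sub>R x + s *\<^sub>R x"
    "r *\<^sub>R s *\<^sub>R x = (r * s) *\<^sub>R x" "1 *\<^sub>R x = x"
    "r *\<^sub>R x * y = r *\<^sub>R (x * y)" "x * r *\<^sub>R y = r *\<^sub>R (x * y)"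
    by (simp_all add: quat_eq_iff algebra_simps)
qed

end

instantiation quat :: real_normed_div_algebra
begin

definition norm_quat :: "quat \<Rightarrow> real" where
  "norm_quat x = sqrt ((qRe x)\<^sup>2 + (qI x)\<^sup>2 + (qJ x)\<^sup>2 + (qK x)\<^sup>2)"

definition sgn_quat :: "quat \<Rightarrow> quat" where
  "sgn_quat x = x /\<^sub>R norm x"

definition dist_quat :: "quat \<Rightarrow> quat \<Rightarrow> real" where
  "dist_quat x y = norm (x - y)"

definition uniformity_quat_def [code del]:
  "(uniformity :: (quat \<times> quat) filter) = (INF e\<in>{0 <..}. principal {(x, y). dist x y < e})"

definition open_quat_def [code del]:
  "open (U :: quat set) \<longleftrightarrow> (\<forall>x\<in>U. eventually (\<lambda>(x', y). x' = x \<longrightarrow> y \<in> U) uniformity)"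

instance
proof
  fix r :: real and x y :: quat and S :: "quat set"
  show "(norm x = 0) = (x = 0)"
    using quat_normsq_eq_0_iff[of x] by (simp add: norm_quat_def quat_normsq_def)
  have tri: "sqrt ((a + b)\<^sup>2 + (c + d)\<^sup>2) \<le> sqrt (a\<^sup>2 + c\<^sup>2) + sqrt (b\<^sup>2 + d\<^sup>2)" for a b c d :: real
    by (rule real_sqrt_sum_squares_triangle_ineq)
  define p q where "p v = sqrt ((qRe v)\<^sup>2 + (qI v)\<^sup>2)" and "q v = sqrt ((qJ v)\<^sup>2 + (qK v)\<^sup>2)"
    for v
  have n: "norm v = sqrt ((p v)\<^sup>2 + (q v)\<^sup>2)" for v
    by (simp add: norm_quat_def p_def q_def add.assoc)
  have "norm (x + y) = sqrt ((p (x + y))\<^sup>2 + (q (x + y))\<^sup>2)"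
    by (rule n)
  also have "\<dots> \<le> sqrt ((p x + p y)\<^sup>2 + (q x + q y)\<^sup>2)"
    using tri by (intro real_sqrt_le_mono add_mono power_mono) (simp_all add: p_def q_def)
  also have "\<dots> \<le> norm x + norm y"
    unfolding n by (rule tri)
  finally show "norm (x + y) \<le> norm x + norm y" .
  have "norm (r *\<^sub>R x) = sqrt (r\<^sup>2 * ((qRe x)\<^sup>2 + (qI x)\<^sup>2 + (qJ x)\<^sup>2 + (qK x)\<^sup>2))"
    by (simp add: norm_quat_def power_mult_distrib algebra_simps)
  then show "norm (r *\<^sub>R x) = \<bar>r\<bar> * norm x"
    by (simp add: norm_quat_def real_sqrt_mult)
  show "norm (x * y) = norm x * norm y"
    unfolding norm_quat_def real_sqrt_mult[symmetric]
    by (simp add: power2_eq_square algebra_simps)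
  show "sgn x = x /\<^sub>R norm x"
    by (rule sgn_quat_def)
  show "dist x y = norm (x - y)"
    by (rule dist_quat_def)
  show "(uniformity :: (quat \<times> quat) filter) = (INF e\<in>{0 <..}. principal {(x, y). dist x y < e})"
    by (rule uniformity_quat_def)
  show "open S \<longleftrightarrow> (\<forall>x\<in>S. eventually (\<lambda>(x', y). x' = x \<longrightarrow> y \<in> S) uniformity)"
    by (rule open_quat_def)
qed

end

section \<open>Conjugation on the three scalar algebras\<close>

text \<open>Conjugation reverses products, so that the quaternions fit in as well.\<close>

class conj_div_algebra = real_normed_div_algebra +
  fixes sconj :: "'a \<Rightarrow> 'a"
  assumes sconj_add: "sconj (x + y) = sconj x + sconj y"
    and sconj_mult: "sconj (x * y) = sconj y * sconj x"
    and sconj_sconj: "sconj (sconj x) = x"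
    and sconj_mult_self: "sconj x * x = ((norm x)\<^sup>2) *\<^sub>R 1"

instantiation real :: conj_div_algebra
begin

definition sconj_real :: "real \<Rightarrow> real" where
  "sconj_real x = x"

instance
  by standard (simp_all add: sconj_real_def power2_eq_square)

end

instantiation complex :: conj_div_algebra
begin

definition sconj_complex :: "complex \<Rightarrow> complex" where
  "sconj_complex = cnj"

instance
  by standard (simp_all add: sconj_complex_def complex_eq_iff cmod_power2, simp_all add: power2_eq_square)

end

instantiation quat :: conj_div_algebra
begin

primcorec sconj_quat where
  "qRe (sconj x) = qRe x"
| "qI (sconj x) = - qI x"
| "qJ (sconj x) = - qJ x"
| "qK (sconj x) = - qK x"

instance
proof
  fix x y :: quat
  show "sconj (x + y) = sconj x + sconj y" "sconj (x * y) = sconj y * sconj x"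
    "sconj (sconj x) = x"
    by (simp_all add: quat_eq_iff algebra_simps)
  have "(norm x)\<^sup>2 = (qRe x)\<^sup>2 + (qI x)\<^sup>2 + (qJ x)\<^sup>2 + (qK x)\<^sup>2"
    by (simp add: norm_quat_def)
  then show "sconj x * x = ((norm x)\<^sup>2) *\<^sub>R 1"
    by (simp add: quat_eq_iff power2_eq_square algebra_simps)
qed

end

section \<open>Matrices\<close>

definition conj_transpose :: "'a::conj_div_algebra^'n^'m \<Rightarrow> 'a^'m^'n" where
  "conj_transpose A = (\<chi> i j. sconj (A $ j $ i))"

definition is_mp_inverse :: "'a::conj_div_algebra^'n^'m \<Rightarrow> 'a^'m^'n \<Rightarrow> bool" where
  "is_mp_inverse A X \<longleftrightarrow>
     A ** X ** A = A \<and>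
     X ** A ** X = X \<and>
     conj_transpose (A ** X) = A ** X \<and>
     conj_transpose (X ** A) = X ** A"

definition mp_inverse :: "'a::conj_div_algebra^'n^'m \<Rightarrow> 'a^'m^'n" where
  "mp_inverse A = (THE X. is_mp_inverse A X)"

text \<open>
  The rank of a matrix over a division ring is the dimension of the space spanned by its
  columns with scalars acting from the right, i.e. the largest number of right linearly
  independent columns. (The library's constant rank needs a commutative field.)
\<close>

definition right_indep_columns :: "'a::division_ring^'n^'m \<Rightarrow> 'n set \<Rightarrow> bool" where
  "right_indep_columns A S \<longleftrightarrow>
     (\<forall>c :: 'n \<Rightarrow> 'a. (\<forall>i. (\<Sum>j\<in>S. A $ i $ j * c j) = 0) \<longrightarrow> (\<forall>j\<in>S. c j = 0))"

definition right_rank :: "'a::division_ring^'n^'m \<Rightarrow> nat" where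
  "right_rank A = Max {card S | S. right_indep_columns A S}"

definition no_zero_element :: "'a::zero^'n^'m \<Rightarrow> bool" where
  "no_zero_element A \<longleftrightarrow> (\<forall>i j. A $ i $ j \<noteq> 0)"

definition diagonal_matrix :: "'a::zero^'n^'n \<Rightarrow> bool" where
  "diagonal_matrix D \<longleftrightarrow> (\<forall>i j. i \<noteq> j \<longrightarrow> D $ i $ j = 0)"

definition positive_diagonal :: "'a::real_normed_div_algebra^'n^'n \<Rightarrow> bool" where
  "positive_diagonal D \<longleftrightarrow>
     diagonal_matrix D \<and> (\<forall>i. \<exists>r::real. r > 0 \<and> D $ i $ i = of_real r)"

definition unitary_diagonal :: "'a::real_normed_div_algebra^'n^'n \<Rightarrow> bool" where
  "unitary_diagonal D \<longleftrightarrow> diagonal_matrix D \<and> (\<forall>i. norm (D $ i $ i) = 1)"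

definition permutation_matrix :: "'a::zero_neq_one^'n^'n \<Rightarrow> bool" where
  "permutation_matrix P \<longleftrightarrow> (\<exists>p. bij p \<and> P = (\<chi> i j. if j = p i then 1 else 0))"

section \<open>General-diagonal scale functions and the induced inverse\<close>

text \<open>
  The functions are total on the matrix type, but they are constrained only on matrices
  without zero elements; these are closed under all the transformations below.
\<close>

definition general_diagonal_scale_functions ::
  "('a::real_normed_div_algebra^'n^'m \<Rightarrow> 'a^'m^'m) \<Rightarrow> ('a^'n^'m \<Rightarrow> 'a^'n^'n) \<Rightarrow> bool" where
  "general_diagonal_scale_functions DL DR \<longleftrightarrow>
     (\<forall>A. no_zero_element A \<longrightarrow>
        positive_diagonal (DL A) \<and> positive_diagonal (DR A) \<and>
        (\<forall>D E. positive_diagonal D \<and> positive_diagonal E \<longrightarrow>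
           DL (D ** A ** E) ** (D ** A ** E) ** DR (D ** A ** E) = DL A ** A ** DR A) \<and>
        (\<forall>P Q. permutation_matrix P \<and> permutation_matrix Q \<longrightarrow>
           DL (P ** A ** Q) ** (P ** A ** Q) ** DR (P ** A ** Q) = P ** (DL A ** A ** DR A) ** Q) \<and>
        (\<forall>D E. unitary_diagonal D \<and> unitary_diagonal E \<longrightarrow> DL (D ** A ** E) = DL A) \<and>
        (\<forall>D E. unitary_diagonal D \<and> unitary_diagonal E \<longrightarrow> DR (D ** A ** E) = DR A))"

definition uc_inverse ::
  "('a::conj_div_algebra^'n^'m \<Rightarrow> 'a^'m^'m) \<Rightarrow> ('a^'n^'m \<Rightarrow> 'a^'n^'n) \<Rightarrow> 'a^'n^'m \<Rightarrow> 'a^'m^'n" where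
  "uc_inverse DL DR A = DR A ** mp_inverse (DL A ** A ** DR A) ** DL A"

end

(* The induced inverse satisfies the first two Penrose equations because the scalings are invertible
   and the Moore-Penrose inverse does.  For (DAE), write D and E as positive times unitary diagonals:
   the unitary parts pass through the Moore-Penrose inverse, and comparing the (j,i) entries of
   the two scaled matrices (A has no zero entry) determines exactly the products of a left and a right
   scale factor that occur in the (i,j) entry of the induced inverse.
   The Moore-Penrose inverse exists over any division algebra with a positive definite conjugation:
   a Hermitian projection onto the column space is built by Gram-Schmidt, one column at a time. *)

theory Submission
  imports Defs
begin

section \<open>Conjugate transposes\<close>

lemma sconj_0 [simp]: "sconj (0::'a::conj_div_algebra) = 0"
  using sconj_add[of "0::'a" 0] by simp

text \<open>The norm identity gives
  \<open>sconj (of_real r) * of_real r = of_real r * of_real r\<close>, and a nonzero real factor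
  cancels.\<close>

lemma sconj_of_real [simp]: "sconj (of_real r :: 'a::conj_div_algebra) = of_real r"
proof (cases "r = 0")
  case False
  have "sconj (of_real r :: 'a) * of_real r = of_real r * of_real r"
    using sconj_mult_self[of "of_real r :: 'a"]
    by (simp add: of_real_def power2_eq_square)
  with False show ?thesis
    by simp
qed simp

lemma sconj_scaleR [simp]: "sconj (r *\<^sub>R x) = r *\<^sub>R sconj (x::'a::conj_div_algebra)"
proof -
  have "sconj (x * of_real r) = of_real r * sconj x"
    by (simp add: sconj_mult)
  then show ?thesis
    by (simp add: of_real_def)
qed

lemma sconj_sum: "sconj (sum f S) = (\<Sum>i\<in>S. sconj (f i :: 'a::conj_div_algebra))"
  by (induction S rule: infinite_finite_induct) (auto simp: sconj_add)

lemma sconj_unit: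
  fixes x :: "'a::conj_div_algebra"
  assumes "norm x = 1"
  shows "sconj x * x = 1" "x * sconj x = 1" "sconj x = inverse x"
proof -
  show left: "sconj x * x = 1"
    using sconj_mult_self[of x] assms by simp
  have "x \<noteq> 0"
    using assms by auto
  then show "sconj x = inverse x"
    using left inverse_unique right_inverse by (metis mult.assoc mult_1 mult_1_right)
  with \<open>x \<noteq> 0\<close> show "x * sconj x = 1"
    by simp
qed

lemma conj_transpose_nth [simp]: "conj_transpose A $ i $ j = sconj (A $ j $ i)"
  by (simp add: conj_transpose_def)

lemma conj_transpose_conj_transpose [simp]: "conj_transpose (conj_transpose A) = A"
  by (simp add: vec_eq_iff sconj_sconj)

lemma conj_transpose_add: "conj_transpose (A + B) = conj_transpose A + conj_transpose B"
  by (simp add: vec_eq_iff sconj_add)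

lemma conj_transpose_scaleR: "conj_transpose (r *\<^sub>R A) = r *\<^sub>R conj_transpose A"
  by (simp add: vec_eq_iff)

lemma conj_transpose_0 [simp]: "conj_transpose 0 = 0"
  by (simp add: vec_eq_iff)

lemma conj_transpose_mult: "conj_transpose (A ** B) = conj_transpose B ** conj_transpose A"
  by (simp add: vec_eq_iff matrix_matrix_mult_def sconj_sum sconj_mult)

section \<open>The Moore-Penrose inverse\<close>

text \<open>Taking adjoints in \<open>A ** X = (A ** Y) ** (A ** X)\<close> reverses the Hermitian
  factors and yields \<open>A ** X = A ** Y\<close>; likewise \<open>X ** A = Y ** A\<close>. Then
  \<open>X = X ** A ** X = X ** A ** Y = Y ** A ** Y = Y\<close>.\<close>

lemma is_mp_inverse_unique:
  assumes X: "is_mp_inverse A X" and Y: "is_mp_inverse A Y"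
  shows "X = Y"
proof -
  note x = X[unfolded is_mp_inverse_def] and y = Y[unfolded is_mp_inverse_def]
  have "A ** X = conj_transpose ((A ** Y) ** (A ** X))"
    using x y by (simp add: matrix_mul_assoc)
  also have "\<dots> = (A ** X) ** (A ** Y)"
    using x y by (simp only: conj_transpose_mult)
  finally have AXY: "A ** X = A ** Y"
    using x by (simp add: matrix_mul_assoc)
  have "X ** A = conj_transpose ((X ** A) ** (Y ** A))"
    using x y by (metis matrix_mul_assoc)
  also have "\<dots> = (Y ** A) ** (X ** A)"
    using x y by (simp only: conj_transpose_mult)
  finally have XAY: "X ** A = Y ** A"
    using x by (metis matrix_mul_assoc)
  show ?thesis
    using AXY XAY x y by (metis matrix_mul_assoc)
qed

section \<open>Gram-Schmidt projections and existence of the Moore-Penrose inverse\<close>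

lemma column_gram:
  fixes v :: "'a::conj_div_algebra^1^'m"
  shows "conj_transpose v ** v = (\<Sum>i\<in>UNIV. (norm (v $ i $ 1))\<^sup>2) *\<^sub>R mat 1"
  by (simp add: vec_eq_iff matrix_matrix_mult_def mat_def sconj_mult_self scaleR_sum_left)

lemma column_gram_pos:
  fixes v :: "'a::conj_div_algebra^1^'m"
  assumes "v \<noteq> 0"
  shows "(\<Sum>i\<in>UNIV. (norm (v $ i $ 1))\<^sup>2) > 0"
proof -
  obtain i where "v $ i $ 1 \<noteq> 0"
    using assms by (auto simp: vec_eq_iff)
  then show ?thesis
    by (intro sum_pos2[of _ i]) auto
qed

lemma matrix_add_rdistrib: "(A + B) ** C = A ** C + B ** (C::'a::semiring_1^'n^'m)"
  by (vector matrix_matrix_mult_def sum.distrib[symmetric] distrib_right)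

lemma matrix_diff_ldistrib: "A ** (B - C) = A ** B - A ** (C::'a::ring_1^'n^'m)"
  by (vector matrix_matrix_mult_def sum_subtractf[symmetric] right_diff_distrib)

lemma matrix_mult_0 [simp]: "A ** 0 = (0::'a::ring_1^'n^'m)" "0 ** B = (0::'a::ring_1^'n^'m)"
  by (simp_all add: vec_eq_iff matrix_matrix_mult_def)

text \<open>The standard basis vector is encoded as a one-column matrix, so that applying a matrix
  to it is again \<open>**\<close> and associativity of matrix products does the work.\<close>

definition basis_column :: "'n \<Rightarrow> 'a::zero_neq_one^1^'n" where
  "basis_column k = (\<chi> i j. if i = k then 1 else 0)"

lemma mult_basis_column: "(A ** basis_column k) $ i $ j = A $ i $ k"
  by (simp add: matrix_matrix_mult_def basis_column_def if_distrib[of "\<lambda>x. _ * x"] cong: if_cong)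

lemma matrix_eq_by_basis_columns:
  assumes "\<And>k. A ** basis_column k = B ** basis_column k"
  shows "A = B"
proof -
  have "A $ i $ k = B $ i $ k" for i k
    using arg_cong[OF assms[of k], of "\<lambda>M. M $ i $ 1"] by (simp add: mult_basis_column)
  then show ?thesis
    by (simp add: vec_eq_iff)
qed

text \<open>Gram-Schmidt with the projection kept in the form \<open>A ** X\<close>: its range then
  stays inside the column space, and once all columns are fixed, \<open>X\<close> is a generalized
  inverse of \<open>A\<close>.\<close>

lemma projection_onto_columns:
  fixes A :: "'a::conj_div_algebra^'n^'m"
  assumes "finite S"
  shows "\<exists>X. conj_transpose (A ** X) = A ** X \<and> A ** X ** (A ** X) = A ** X \<and>
     (\<forall>k\<in>S. A ** X ** (A ** basis_column k) = A ** basis_column k)"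
  using assms
proof (induction S)
  case empty
  show ?case
    by (rule exI[of _ 0]) simp
next
  case (insert k S)
  then obtain X where
    herm: "conj_transpose (A ** X) = A ** X" and idem: "A ** X ** (A ** X) = A ** X" and
    fixd: "\<And>j. j \<in> S \<Longrightarrow> A ** X ** (A ** basis_column j) = A ** basis_column j"
    by auto
  define P where "P = A ** X"
  define a :: "'a^1^'m" where "a = A ** basis_column k"
  \<comment> \<open>The residual of \<open>a\<close> after projection is itself
    \<open>A ** w\<close>, so the correction along it can be absorbed into \<open>X\<close>.\<close>
  define w where "w = basis_column k - X ** a"
  define v where "v = A ** w"
  have v: "v = a - P ** a"
    by (simp add: v_def w_def a_def P_def matrix_diff_ldistrib matrix_mul_assoc)
  show ?case
  proof (cases "v = 0")
    case True
    then have "P ** a = a"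
      using v by simp
    then show ?thesis
      using herm idem fixd by (auto simp: P_def a_def intro!: exI[of _ X])
  next
    case False
    \<comment> \<open>The squared length of the residual is real, so it commutes with all scalars,
      quaternions included.\<close>
    define c where "c = (\<Sum>i\<in>UNIV. (norm (v $ i $ 1))\<^sup>2)"
    have c: "c > 0"
      using column_gram_pos[OF False] by (simp add: c_def)
    have vv: "conj_transpose v ** v = c *\<^sub>R mat 1"
      by (simp add: column_gram c_def)
    \<comment> \<open>The residual is orthogonal to the range of \<open>P\<close>: idempotence gives
      \<open>P ** v = 0\<close>, and the adjoint of this is the mirrored identity.\<close>
    have Pv: "P ** v = 0"
      using idem by (simp add: v P_def matrix_diff_ldistrib matrix_mul_assoc)
    have vP: "conj_transpose v ** P = 0"
      using arg_cong[OF Pv, of conj_transpose] herm by (simp add: conj_transpose_mult P_def)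
    \<comment> \<open>\<open>Q\<close> is the orthogonal projection onto the line spanned by
      \<open>v\<close>.\<close>
    define Q where "Q = inverse c *\<^sub>R (v ** conj_transpose v)"
    define Y where "Y = X + inverse c *\<^sub>R (w ** conj_transpose v)"
    have AY: "A ** Y = P + Q"
      by (simp add: Y_def Q_def P_def v_def matrix_add_ldistrib matrix_scalar_ac matrix_mul_assoc
          flip: scalar_matrix_assoc)
    have "conj_transpose (P + Q) = P + Q"
      using herm by (simp add: Q_def P_def conj_transpose_add conj_transpose_scaleR conj_transpose_mult)
    moreover have QP: "Q ** P = 0"
      using vP by (simp add: Q_def flip: scalar_matrix_assoc matrix_mul_assoc)
    have PQ: "P ** Q = 0"
      using Pv by (simp add: Q_def matrix_scalar_ac matrix_mul_assoc flip: scalar_matrix_assoc)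
    have Qv: "Q ** v = v"
      using c vv by (simp add: Q_def matrix_scalar_ac flip: scalar_matrix_assoc matrix_mul_assoc)
    have QQ: "Q ** Q = Q"
    proof -
      have "Q ** Q = inverse c *\<^sub>R ((Q ** v) ** conj_transpose v)"
        by (subst (2) Q_def) (simp add: matrix_scalar_ac matrix_mul_assoc flip: scalar_matrix_assoc)
      then show ?thesis
        by (simp add: Qv flip: Q_def)
    qed
    have "(P + Q) ** (P + Q) = P + Q"
      using idem QP PQ QQ
      by (simp add: matrix_add_ldistrib matrix_add_rdistrib P_def)
    moreover have "(P + Q) ** (A ** basis_column j) = A ** basis_column j" if "j \<in> S" for j
    proof -
      \<comment> \<open>Columns treated earlier lie in the range of \<open>P\<close>, which
        \<open>Q\<close> annihilates.\<close>
      have "Q ** (A ** basis_column j) = Q ** P ** (A ** basis_column j)"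
        using fixd[OF that] by (simp add: P_def flip: matrix_mul_assoc)
      then show ?thesis
        using fixd[OF that] by (simp add: matrix_add_rdistrib QP flip: P_def)
    qed
    moreover have "(P + Q) ** a = a"
    proof -
      \<comment> \<open>Split \<open>a\<close> into its residual \<open>v\<close> and its projected
        part \<open>P ** a\<close>.\<close>
      have "Q ** a = Q ** v + Q ** P ** a"
        by (simp add: v matrix_diff_ldistrib matrix_mul_assoc)
      then show ?thesis
        by (simp add: matrix_add_rdistrib QP Qv) (simp add: v)
    qed
    ultimately show ?thesis
      by (intro exI[of _ Y]) (auto simp: AY a_def)
  qed
qed

lemma hermitian_generalized_inverse_exists:
  fixes A :: "'a::conj_div_algebra^'n^'m"
  obtains X where "A ** X ** A = A" "conj_transpose (A ** X) = A ** X"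
proof -
  obtain X where herm: "conj_transpose (A ** X) = A ** X"
    and fixd: "\<forall>k\<in>UNIV. A ** X ** (A ** basis_column k) = A ** basis_column k"
    using projection_onto_columns[OF finite[of "UNIV :: 'n set"], of A] by (elim exE conjE)
  have "A ** X ** A = A"
  proof (rule matrix_eq_by_basis_columns)
    show "A ** X ** A ** basis_column k = A ** basis_column k" for k
      using fixd unfolding matrix_mul_assoc by (rule bspec) (rule UNIV_I)
  qed
  with herm show thesis
    using that by blast
qed

text \<open>Urquhart's construction: if \<open>X\<close> and \<open>Y\<close> are generalized
  inverses with \<open>A ** X\<close> and \<open>Y ** A\<close> Hermitian, then
  \<open>Y ** A ** X\<close> satisfies all four Penrose equations. Such a \<open>Y\<close> is the
  adjoint of an inverse of the first kind for the adjoint matrix.\<close>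

lemma is_mp_inverse_exists:
  fixes A :: "'a::conj_div_algebra^'n^'m"
  shows "\<exists>X. is_mp_inverse A X"
proof -
  obtain X where X: "A ** X ** A = A" "conj_transpose (A ** X) = A ** X"
    by (rule hermitian_generalized_inverse_exists)
  obtain Z where Z: "conj_transpose A ** Z ** conj_transpose A = conj_transpose A"
      "conj_transpose (conj_transpose A ** Z) = conj_transpose A ** Z"
    by (rule hermitian_generalized_inverse_exists)
  define Y where "Y = conj_transpose Z"
  have Y: "A ** Y ** A = A"
    using arg_cong[OF Z(1), of conj_transpose]
    by (simp add: conj_transpose_mult Y_def matrix_mul_assoc)
  have YA: "conj_transpose (Y ** A) = Y ** A"
    using Z(2) by (simp add: conj_transpose_mult Y_def)
  define W where "W = Y ** A ** X"
  have AW: "A ** W = A ** X"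
    using Y by (simp add: W_def matrix_mul_assoc)
  have WA: "W ** A = Y ** A"
    using X(1) by (metis W_def matrix_mul_assoc)
  have "W ** A ** W = W"
    unfolding WA by (metis AW W_def matrix_mul_assoc)
  then have "is_mp_inverse A W"
    unfolding is_mp_inverse_def using X YA AW WA by simp
  then show ?thesis ..
qed

lemma is_mp_inverse_mp_inverse: "is_mp_inverse A (mp_inverse A)"
  unfolding mp_inverse_def
  by (rule theI') (use is_mp_inverse_exists is_mp_inverse_unique in blast)

section \<open>Equivariance of the Moore-Penrose inverse under unitary factors\<close>

lemma hermitian_congruence:
  assumes "conj_transpose H = H"
  shows "conj_transpose (U ** H ** conj_transpose U) = U ** H ** conj_transpose U"
  using assms by (simp add: conj_transpose_mult matrix_mul_assoc)

text \<open>By uniqueness it suffices to verify the Penrose equations for the right-hand side; its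
  two products with \<open>U ** A ** V\<close> are unitary conjugates of
  \<open>A ** mp_inverse A\<close> and \<open>mp_inverse A ** A\<close>.\<close>

lemma mp_inverse_unitary:
  assumes U: "conj_transpose U ** U = mat 1" "U ** conj_transpose U = mat 1"
    and V: "conj_transpose V ** V = mat 1" "V ** conj_transpose V = mat 1"
  shows "mp_inverse (U ** A ** V) = conj_transpose V ** mp_inverse A ** conj_transpose U"
proof (rule is_mp_inverse_unique[OF is_mp_inverse_mp_inverse])
  let ?X = "mp_inverse A"
  let ?Y = "conj_transpose V ** ?X ** conj_transpose U"
  note X = is_mp_inverse_mp_inverse[of A, unfolded is_mp_inverse_def]
  have AY: "U ** A ** V ** ?Y = U ** (A ** ?X) ** conj_transpose U"
    by (metis V(2) matrix_mul_assoc matrix_mul_rid)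
  have YA: "?Y ** (U ** A ** V) = conj_transpose V ** (?X ** A) ** V"
    by (metis U(1) matrix_mul_assoc matrix_mul_rid)
  have 1: "U ** A ** V ** ?Y ** (U ** A ** V) = U ** A ** V"
    unfolding AY by (metis U(1) X matrix_mul_assoc matrix_mul_rid)
  have 2: "?Y ** (U ** A ** V) ** ?Y = ?Y"
    unfolding YA by (metis V(2) X matrix_mul_assoc matrix_mul_rid)
  show "is_mp_inverse (U ** A ** V) ?Y"
    unfolding is_mp_inverse_def
  proof (intro conjI 1 2)
    show "conj_transpose (U ** A ** V ** ?Y) = U ** A ** V ** ?Y"
      unfolding AY using X by (intro hermitian_congruence) blast
    show "conj_transpose (?Y ** (U ** A ** V)) = ?Y ** (U ** A ** V)"
      unfolding YA using X hermitian_congruence[of "?X ** A" "conj_transpose V"] by simp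
  qed
qed

section \<open>Diagonal matrices\<close>

definition diag :: "('n \<Rightarrow> 'a::zero) \<Rightarrow> 'a^'n^'n" where
  "diag d = (\<chi> i j. if i = j then d i else 0)"

lemma diag_nth: "diag d $ i $ j = (if i = j then d i else 0)"
  by (simp add: diag_def)

lemma diag_mult_nth: "(diag d ** A) $ i $ j = d i * (A $ i $ j :: 'a::ring_1)"
  by (simp add: diag_def matrix_matrix_mult_def if_distrib[of "\<lambda>x. x * _"] cong: if_cong)

lemma mult_diag_nth: "(A ** diag d) $ i $ j = A $ i $ j * (d j :: 'a::ring_1)"
  by (simp add: diag_def matrix_matrix_mult_def if_distrib[of "\<lambda>x. _ * x"] cong: if_cong)

lemma diag_mult_diag: "diag d ** diag e = diag (\<lambda>i. d i * (e i :: 'a::ring_1))"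
  by (simp add: vec_eq_iff diag_mult_nth diag_nth)

lemma diag_1: "diag (\<lambda>_. 1) = (mat 1 :: 'a::ring_1^'n^'n)"
  by (simp add: vec_eq_iff diag_nth mat_def)

lemma conj_transpose_diag: "conj_transpose (diag d) = diag (\<lambda>i. sconj (d i))"
  by (simp add: vec_eq_iff diag_nth)

lemma diagonal_matrix_eq_diag: "diagonal_matrix D \<longleftrightarrow> D = diag (\<lambda>i. D $ i $ i)"
  by (auto simp: diagonal_matrix_def vec_eq_iff diag_nth)

lemma diagonal_matrix_diag: "diagonal_matrix (diag d)"
  by (simp add: diagonal_matrix_def diag_nth)

lemma matrix_inv_eqI:
  fixes A :: "'a::semiring_1^'n^'n"
  assumes "A ** B = mat 1" "B ** A = mat 1"
  shows "matrix_inv A = B"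
proof -
  have "A ** matrix_inv A = mat 1 \<and> matrix_inv A ** A = mat 1"
    unfolding matrix_inv_def by (rule someI[of _ B]) (simp add: assms)
  then show ?thesis
    by (metis assms matrix_mul_assoc matrix_mul_lid matrix_mul_rid)
qed

lemma diag_inverse:
  fixes d :: "'n::finite \<Rightarrow> 'a::division_ring"
  assumes "\<And>i. d i \<noteq> 0"
  shows "diag d ** diag (\<lambda>i. inverse (d i)) = mat 1" "diag (\<lambda>i. inverse (d i)) ** diag d = mat 1"
  using assms by (simp_all add: diag_mult_diag diag_1)

lemma invertible_diagD:
  fixes d :: "'n::finite \<Rightarrow> 'a::division_ring"
  assumes "invertible (diag d)"
  shows "d i \<noteq> 0"
proof -
  obtain X where "diag d ** X = mat 1"
    using assms by (auto simp: invertible_def)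
  then have "(diag d ** X) $ i $ i = 1"
    by (simp add: mat_def)
  then show ?thesis
    by (auto simp: diag_mult_nth)
qed

lemma positive_diagonalE:
  assumes "positive_diagonal D"
  obtains d where "\<And>i. d i > 0" "D = diag (\<lambda>i. of_real (d i))"
proof -
  obtain d where d: "\<And>i. d i > 0 \<and> D $ i $ i = of_real (d i)"
    using assms unfolding positive_diagonal_def by metis
  with assms show thesis
    by (intro that[of d]) (auto simp: positive_diagonal_def diagonal_matrix_eq_diag)
qed

lemma positive_diagonal_diag:
  "(\<And>i. d i > 0) \<Longrightarrow> positive_diagonal (diag (\<lambda>i. of_real (d i)))"
  by (auto simp: positive_diagonal_def diagonal_matrix_diag diag_nth)

lemma unitary_diagonal_diag: "(\<And>i. norm (d i) = 1) \<Longrightarrow> unitary_diagonal (diag d)"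
  by (auto simp: unitary_diagonal_def diagonal_matrix_diag diag_nth)

lemma diag_unitary:
  fixes d :: "'n::finite \<Rightarrow> 'a::conj_div_algebra"
  assumes "\<And>i. norm (d i) = 1"
  shows "conj_transpose (diag d) ** diag d = mat 1" "diag d ** conj_transpose (diag d) = mat 1"
  using assms by (simp_all add: conj_transpose_diag diag_mult_diag sconj_unit(1,2) diag_1)

section \<open>The inverse induced by scale functions\<close>

lemma general_diagonal_scale_functionsD:
  assumes "general_diagonal_scale_functions DL DR" "no_zero_element A"
  shows "positive_diagonal (DL A)" "positive_diagonal (DR A)"
    "positive_diagonal D \<Longrightarrow> positive_diagonal E \<Longrightarrow>
      DL (D ** A ** E) ** (D ** A ** E) ** DR (D ** A ** E) = DL A ** A ** DR A"
    "unitary_diagonal D \<Longrightarrow> unitary_diagonal E \<Longrightarrow> DL (D ** A ** E) = DL A"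
    "unitary_diagonal D \<Longrightarrow> unitary_diagonal E \<Longrightarrow> DR (D ** A ** E) = DR A"
  using assms unfolding general_diagonal_scale_functions_def by blast+

lemma uc_inverse_reflexive:
  fixes A :: "'a::conj_div_algebra^'n^'m"
  assumes "general_diagonal_scale_functions DL DR" "no_zero_element A"
  shows "A ** uc_inverse DL DR A ** A = A"
    and "uc_inverse DL DR A ** A ** uc_inverse DL DR A = uc_inverse DL DR A"
proof -
  obtain l where l: "\<And>i. l i > 0" "DL A = diag (\<lambda>i. of_real (l i))"
    using general_diagonal_scale_functionsD(1)[OF assms] by (rule positive_diagonalE) blast
  obtain r where r: "\<And>i. r i > 0" "DR A = diag (\<lambda>i. of_real (r i))"
    using general_diagonal_scale_functionsD(2)[OF assms] by (rule positive_diagonalE) blast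
  obtain L where L: "DL A ** L = mat 1" "L ** DL A = mat 1"
    using diag_inverse[of "\<lambda>i. of_real (l i) :: 'a"] l by (metis of_real_eq_0_iff less_irrefl)
  obtain R where R: "DR A ** R = mat 1" "R ** DR A = mat 1"
    using diag_inverse[of "\<lambda>i. of_real (r i) :: 'a"] r by (metis of_real_eq_0_iff less_irrefl)
  define S where "S = DL A ** A ** DR A"
  define X where "X = mp_inverse S"
  have X: "S ** X ** S = S" "X ** S ** X = X"
    using is_mp_inverse_mp_inverse[of S] by (auto simp: is_mp_inverse_def X_def)
  have U: "uc_inverse DL DR A = DR A ** X ** DL A"
    by (simp add: uc_inverse_def X_def S_def)
  have A: "A = L ** S ** R"
    unfolding S_def by (metis L(2) R(1) matrix_mul_assoc matrix_mul_lid matrix_mul_rid)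
  \<comment> \<open>\<open>L\<close> and \<open>R\<close> are the inverses of the scalings. The
    right scaling cancels, leaving the projection \<open>S ** X\<close> conjugated by
    \<open>DL A\<close>.\<close>
  have AU: "A ** uc_inverse DL DR A = L ** (S ** X) ** DL A"
    unfolding U by (subst A) (metis R(2) matrix_mul_assoc matrix_mul_rid)
  have "DL A ** A = S ** R"
    unfolding S_def by (metis R(1) matrix_mul_assoc matrix_mul_rid)
  then have "A ** uc_inverse DL DR A ** A = L ** (S ** X ** S) ** R"
    unfolding AU by (metis matrix_mul_assoc)
  also have "\<dots> = A"
    by (simp add: X flip: A)
  finally show "A ** uc_inverse DL DR A ** A = A" .
  have "uc_inverse DL DR A ** A ** uc_inverse DL DR A = DR A ** X ** (DL A ** L) ** (S ** X) ** DL A"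
    by (metis AU U matrix_mul_assoc)
  also have "\<dots> = DR A ** (X ** S ** X) ** DL A"
    unfolding L(1) by (simp add: matrix_mul_assoc)
  finally show "uc_inverse DL DR A ** A ** uc_inverse DL DR A = uc_inverse DL DR A"
    by (simp add: X flip: U)
qed

text \<open>Equality of the scaled matrices does not fix the left and right factors separately,
  since a positive constant may move from one side to the other. It does fix their products, and
  each entry of the induced inverse involves only such a product.\<close>

lemma uc_inverse_diagonal:
  fixes A :: "'a::conj_div_algebra^'n^'m"
  assumes scale: "general_diagonal_scale_functions DL DR" and nz: "no_zero_element A"
    and "diagonal_matrix D" "invertible D" "diagonal_matrix E" "invertible E"
  shows "uc_inverse DL DR (D ** A ** E) = matrix_inv E ** uc_inverse DL DR A ** matrix_inv D"
proof -
  obtain d e where D: "D = diag d" and E: "E = diag e"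
    using assms diagonal_matrix_eq_diag by metis
  have d: "d i \<noteq> 0" and e: "e j \<noteq> 0" for i j
    using invertible_diagD assms D E by metis+
  have invD: "matrix_inv D = diag (\<lambda>i. inverse (d i))" and invE: "matrix_inv E = diag (\<lambda>i. inverse (e i))"
    unfolding D E by (intro matrix_inv_eqI diag_inverse d e)+
  \<comment> \<open>Polar decomposition of the diagonal entries. The moduli are real, hence central,
    so it works for quaternions as well.\<close>
  define u v where "u i = d i /\<^sub>R norm (d i)" and "v j = e j /\<^sub>R norm (e j)" for i j
  have u: "norm (u i) = 1" and v: "norm (v j) = 1" for i j
    using d e by (simp_all add: u_def v_def)
  define Dp :: "'a^'m^'m" where "Dp = diag (\<lambda>i. of_real (norm (d i)))"
  define Ep :: "'a^'n^'n" where "Ep = diag (\<lambda>i. of_real (norm (e i)))"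
  \<comment> \<open>\<open>B\<close> is the intermediate stage: positive scaling leads from
    \<open>A\<close> to \<open>B\<close>, unitary scaling from \<open>B\<close> to
    \<open>D ** A ** E\<close>.\<close>
  define B where "B = Dp ** A ** Ep"
  have B_nth: "B $ i $ j = (norm (d i) * norm (e j)) *\<^sub>R A $ i $ j" for i j
    by (simp add: B_def Dp_def Ep_def diag_mult_nth mult_diag_nth of_real_def)
  have B: "no_zero_element B"
    using nz d e by (simp add: no_zero_element_def B_nth)
  have DAE: "D ** A ** E = diag u ** B ** diag v"
  proof -
    have "d i * A $ i $ j * e j = u i * B $ i $ j * v j" for i j
    proof -
      have "d i = norm (d i) *\<^sub>R u i" "e j = norm (e j) *\<^sub>R v j"
        using d e by (simp_all add: u_def v_def)
      then have "d i * A $ i $ j * e j = (norm (d i) *\<^sub>R u i) * A $ i $ j * (norm (e j) *\<^sub>R v j)"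
        by (rule arg_cong2[where f = "\<lambda>x y. x * A $ i $ j * y"])
      then show ?thesis
        by (simp add: B_nth mult.commute)
    qed
    then show ?thesis
      by (simp add: vec_eq_iff D E diag_mult_nth mult_diag_nth)
  qed
  have pos: "positive_diagonal Dp" "positive_diagonal Ep"
    using d e by (auto simp: Dp_def Ep_def intro!: positive_diagonal_diag)
  have un: "unitary_diagonal (diag u)" "unitary_diagonal (diag v)"
    using u v by (auto intro!: unitary_diagonal_diag)
  obtain lA where lA: "\<And>i. lA i > 0" "DL A = diag (\<lambda>i. of_real (lA i))"
    using general_diagonal_scale_functionsD(1)[OF scale nz] by (rule positive_diagonalE) blast
  obtain rA where rA: "\<And>i. rA i > 0" "DR A = diag (\<lambda>i. of_real (rA i))"
    using general_diagonal_scale_functionsD(2)[OF scale nz] by (rule positive_diagonalE) blast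
  obtain lB where lB: "\<And>i. lB i > 0" "DL B = diag (\<lambda>i. of_real (lB i))"
    using general_diagonal_scale_functionsD(1)[OF scale B] by (rule positive_diagonalE) blast
  obtain rB where rB: "\<And>i. rB i > 0" "DR B = diag (\<lambda>i. of_real (rB i))"
    using general_diagonal_scale_functionsD(2)[OF scale B] by (rule positive_diagonalE) blast
  have L: "DL (D ** A ** E) = DL B" and R: "DR (D ** A ** E) = DR B"
    unfolding DAE using general_diagonal_scale_functionsD(4,5)[OF scale B] un by auto
  have SB: "DL B ** B ** DR B = DL A ** A ** DR A"
    unfolding B_def using general_diagonal_scale_functionsD(3)[OF scale nz] pos by auto
  \<comment> \<open>A row index of the inverse is a column index of \<open>A\<close>, so the entries
    at \<open>(j, i)\<close> are compared; \<open>A $ j $ i\<close> is nonzero and cancels.\<close>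
  have key: "rB i * lB j = rA i * lA j / (norm (e i) * norm (d j))" for i j
  proof -
    have "(lB j * (norm (d j) * norm (e i)) * rB i) *\<^sub>R A $ j $ i = (lA j * rA i) *\<^sub>R A $ j $ i"
      using arg_cong[OF SB, of "\<lambda>M. M $ j $ i"]
      by (simp add: lA rA lB rB diag_mult_nth mult_diag_nth B_nth of_real_def mult_ac)
    then have "lB j * (norm (d j) * norm (e i)) * rB i = lA j * rA i"
      using nz by (simp add: no_zero_element_def)
    then show ?thesis
      using d e by (simp add: field_simps)
  qed
  define M where "M = mp_inverse (DL A ** A ** DR A)"
  \<comment> \<open>The real diagonal scalings commute with the unitary ones, which therefore move
    to the outside.\<close>
  have "DL B ** (diag u ** B ** diag v) ** DR B = diag u ** (DL A ** A ** DR A) ** diag v"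
    unfolding SB[symmetric]
    by (simp add: vec_eq_iff diag_mult_nth mult_diag_nth lB rB of_real_def)
  then have "mp_inverse (DL B ** (diag u ** B ** diag v) ** DR B) =
      diag (\<lambda>i. inverse (v i)) ** M ** diag (\<lambda>i. inverse (u i))"
    by (simp add: mp_inverse_unitary[OF diag_unitary[OF u] diag_unitary[OF v]] M_def
        conj_transpose_diag sconj_unit[OF u] sconj_unit[OF v])
  then have lhs: "uc_inverse DL DR (D ** A ** E) =
      DR B ** (diag (\<lambda>i. inverse (v i)) ** M ** diag (\<lambda>i. inverse (u i))) ** DL B"
    unfolding uc_inverse_def L R by (simp only: DAE)
  \<comment> \<open>The inverse moduli split off here are the denominators in
    \<open>key\<close>.\<close>
  have inv: "inverse (e i) = inverse (norm (e i)) *\<^sub>R inverse (v i)"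
    "inverse (d j) = inverse (norm (d j)) *\<^sub>R inverse (u j)" for i j
    using d e by (simp_all add: u_def v_def inverse_scaleR_distrib)
  have "uc_inverse DL DR (D ** A ** E) $ i $ j =
      (matrix_inv E ** uc_inverse DL DR A ** matrix_inv D) $ i $ j" for i j
  proof -
    have "uc_inverse DL DR (D ** A ** E) $ i $ j =
        (rB i * lB j) *\<^sub>R (inverse (v i) * M $ i $ j * inverse (u j))"
      by (simp add: lhs lB rB diag_mult_nth mult_diag_nth of_real_def mult.commute)
    also have "\<dots> = (rA i * lA j / (norm (e i) * norm (d j))) *\<^sub>R (inverse (v i) * M $ i $ j * inverse (u j))"
      by (simp only: key)
    also have "\<dots> = (matrix_inv E ** (DR A ** M ** DL A) ** matrix_inv D) $ i $ j"
      by (simp add: invD invE inv lA rA diag_mult_nth mult_diag_nth of_real_def divide_inverse mult_ac)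
    also have "DR A ** M ** DL A = uc_inverse DL DR A"
      by (simp add: uc_inverse_def M_def)
    finally show ?thesis .
  qed
  then show ?thesis
    by (simp add: vec_eq_iff)
qed

section \<open>Ranks of reflexive generalized inverses\<close>

lemma rank_mult_le_right:
  fixes A :: "'a::field^'n^'m" and B :: "'a^'k^'n"
  shows "rank (A ** B) \<le> rank B"
proof -
  have "row i (A ** B) = (\<Sum>j\<in>UNIV. A $ i $ j *s row j B)" for i
    by (simp add: vec_eq_iff row_def matrix_matrix_mult_def)
  moreover have "(\<Sum>j\<in>UNIV. A $ i $ j *s row j B) \<in> vec.span (rows B)" for i
    by (intro vec.span_sum vec.span_scale vec.span_base) (auto simp: rows_def)
  ultimately have "rows (A ** B) \<subseteq> vec.span (rows B)"
    by (auto simp: rows_def)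
  then show ?thesis
    unfolding row_rank_def_gen by (rule vec.dim_mono)
qed

text \<open>Commutativity lets \<open>transpose B\<close> act linearly on the rows of
  \<open>A\<close>, producing the rows of the product.\<close>

lemma rank_mult_le_left:
  fixes A :: "'a::field^'n^'m" and B :: "'a^'k^'n"
  shows "rank (A ** B) \<le> rank A"
proof -
  have "row i (A ** B) = transpose B *v row i A" for i
    by (simp add: vec_eq_iff row_def matrix_matrix_mult_def matrix_vector_mult_def transpose_def mult.commute)
  then have "rows (A ** B) = (*v) (transpose B) ` rows A"
    by (auto simp: rows_def)
  then show ?thesis
    unfolding row_rank_def_gen by (simp only: vec.dim_image_le[OF matrix_vector_mul_linear_gen])
qed

lemma rank_generalized_inverse_ge:
  fixes A :: "'a::field^'n^'m"
  assumes "A ** X ** A = A"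
  shows "rank A \<le> rank X"
  by (metis assms order_trans rank_mult_le_left rank_mult_le_right)

section \<open>Column rank of products over a division ring\<close>

text \<open>Gaussian elimination, by induction on the equations; it supplies the exchange argument
  for ranks. Coefficients stand left of the unknowns, so equations are combined with multipliers
  from the left.\<close>

lemma homogeneous_system_nontrivial_solution:
  fixes B :: "'i \<Rightarrow> 'j \<Rightarrow> 'a::division_ring"
  assumes "finite T" "finite S" "card T < card S"
  shows "\<exists>c. (\<exists>j\<in>S. c j \<noteq> 0) \<and> (\<forall>i\<in>T. (\<Sum>j\<in>S. B i j * c j) = 0)"
  using assms
proof (induction T arbitrary: S B rule: finite_induct)
  case empty
  then obtain j where "j \<in> S"
    by fastforce
  then show ?case
    by (intro exI[of _ "\<lambda>_. 1"]) auto
next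
  case (insert t T)
  show ?case
  proof (cases "\<forall>j\<in>S. B t j = 0")
    case True
    from insert have "card T < card S"
      by simp
    with insert.IH[OF insert.prems(1)] obtain c where
      "\<exists>j\<in>S. c j \<noteq> 0" "\<forall>i\<in>T. (\<Sum>j\<in>S. B i j * c j) = 0"
      by blast
    with True show ?thesis
      by (intro exI[of _ c]) auto
  next
    case False
    then obtain k where k: "k \<in> S" "B t k \<noteq> 0"
      by blast
    define S' where "S' = S - {k}"
    \<comment> \<open>Subtract from each equation the left multiple of equation \<open>t\<close>
      that removes the pivot unknown \<open>k\<close>.\<close>
    define B' where "B' i j = B i j - B i k * inverse (B t k) * B t j" for i j
    have "card T < card S'" "finite S'"
      using insert k by (auto simp: S'_def)
    with insert.IH obtain c where
      c: "\<exists>j\<in>S'. c j \<noteq> 0" "\<forall>i\<in>T. (\<Sum>j\<in>S'. B' i j * c j) = 0"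
      by blast
    define s where "s = (\<Sum>j\<in>S'. B t j * c j)"
    \<comment> \<open>Back substitution: the value at \<open>k\<close> is the one that equation
      \<open>t\<close> forces.\<close>
    define c' where "c' = c(k := - (inverse (B t k) * s))"
    have sum: "(\<Sum>j\<in>S. B i j * c' j) = (\<Sum>j\<in>S'. B i j * c j) - B i k * inverse (B t k) * s" for i
    proof -
      have "(\<Sum>j\<in>S. B i j * c' j) = B i k * c' k + (\<Sum>j\<in>S'. B i j * c' j)"
        using insert.prems k by (simp add: S'_def sum.remove)
      also have "(\<Sum>j\<in>S'. B i j * c' j) = (\<Sum>j\<in>S'. B i j * c j)"
        by (intro sum.cong) (auto simp: c'_def S'_def)
      finally show ?thesis
        by (simp add: c'_def mult.assoc)
    qed
    have "(\<Sum>j\<in>S. B t j * c' j) = 0"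
      using k by (simp add: sum flip: s_def)
    moreover have "(\<Sum>j\<in>S. B i j * c' j) = 0" if "i \<in> T" for i
    proof -
      have "(\<Sum>j\<in>S'. B' i j * c j) = (\<Sum>j\<in>S'. B i j * c j) - B i k * inverse (B t k) * s"
        by (simp add: B'_def s_def left_diff_distrib sum_subtractf sum_distrib_left mult.assoc)
      with c(2) that show ?thesis
        by (simp add: sum)
    qed
    moreover have "\<exists>j\<in>S. c' j \<noteq> 0"
      using c(1) by (auto simp: c'_def S'_def)
    ultimately show ?thesis
      by (intro exI[of _ c']) auto
  qed
qed

lemma right_rank_ge: "right_indep_columns A S \<Longrightarrow> card S \<le> right_rank A"
  unfolding right_rank_def by (rule Max_ge) auto

lemma right_rank_attained:
  obtains S where "right_indep_columns A S" "right_rank A = card S"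
proof -
  have "right_rank A \<in> {card S | S. right_indep_columns A S}"
    unfolding right_rank_def
    \<comment> \<open>The empty set of columns is independent, so the maximum is taken over a
      nonempty set.\<close>
    by (rule Max_in) (auto simp: right_indep_columns_def intro!: exI[of _ "{}"])
  then show thesis
    using that by auto
qed

text \<open>Adjoining \<open>k\<close> to \<open>T\<close> creates a relation. Its coefficient at
  \<open>k\<close> is nonzero, because \<open>T\<close> alone is independent, and can be divided out
  from the right.\<close>

lemma column_in_span_of_maximal:
  fixes A :: "'a::division_ring^'n^'m"
  assumes T: "right_indep_columns A T" "right_rank A = card T"
  shows "\<exists>b. \<forall>i. A $ i $ k = (\<Sum>t\<in>T. A $ i $ t * b t)"
proof (cases "k \<in> T")
  case True
  then show ?thesis
    by (intro exI[of _ "\<lambda>t. if t = k then 1 else 0"])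
      (simp add: if_distrib[of "\<lambda>x. _ * x"] cong: if_cong)
next
  case False
  then have "\<not> right_indep_columns A (insert k T)"
    using right_rank_ge[of A "insert k T"] T by auto
  then obtain c where c: "\<And>i. (\<Sum>j\<in>insert k T. A $ i $ j * c j) = 0"
    and nz: "\<exists>j\<in>insert k T. c j \<noteq> 0"
    by (auto simp: right_indep_columns_def)
  have c': "A $ i $ k * c k + (\<Sum>j\<in>T. A $ i $ j * c j) = 0" for i
    using c[of i] False by simp
  have ck: "c k \<noteq> 0"
  proof
    assume "c k = 0"
    then have "\<forall>j\<in>T. c j = 0"
      using c' T(1) by (auto simp: right_indep_columns_def)
    with nz \<open>c k = 0\<close> show False
      by auto
  qed
  have "A $ i $ k = (\<Sum>t\<in>T. A $ i $ t * - (c t * inverse (c k)))" for i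
  proof -
    have "A $ i $ k * c k = - (\<Sum>j\<in>T. A $ i $ j * c j)"
      using c'[of i] by (simp add: eq_neg_iff_add_eq_0)
    then have "A $ i $ k * c k * inverse (c k) = - (\<Sum>j\<in>T. A $ i $ j * c j) * inverse (c k)"
      by simp
    then show ?thesis
      using ck by (simp add: mult.assoc sum_distrib_right sum_negf)
  qed
  then show ?thesis
    by (intro exI[of _ "\<lambda>t. - (c t * inverse (c k))"]) auto
qed

text \<open>The product factors through the columns of \<open>A\<close> in a maximal independent set
  \<open>T\<close>. More than \<open>card T\<close> columns of the product have dependent coordinate
  vectors, and hence are dependent themselves.\<close>

lemma right_rank_mult_le_left:
  fixes A :: "'a::division_ring^'n^'m" and B :: "'a^'k^'n"
  shows "right_rank (A ** B) \<le> right_rank A"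
proof (rule ccontr)
  assume less: "\<not> ?thesis"
  obtain T where T: "right_indep_columns A T" "right_rank A = card T"
    by (rule right_rank_attained)
  obtain S where S: "right_indep_columns (A ** B) S" "right_rank (A ** B) = card S"
    by (rule right_rank_attained)
  obtain b where b: "\<And>i k. A $ i $ k = (\<Sum>t\<in>T. A $ i $ t * b k t)"
    using column_in_span_of_maximal[OF T] by metis
  \<comment> \<open>Column \<open>j\<close> of \<open>C\<close> holds coordinates of column
    \<open>j\<close> of \<open>A ** B\<close> with respect to \<open>T\<close>.\<close>
  define C where "C t j = (\<Sum>k\<in>UNIV. b k t * B $ k $ j)" for t j
  have AB: "(A ** B) $ i $ j = (\<Sum>t\<in>T. A $ i $ t * C t j)" for i j
  proof -
    have "(A ** B) $ i $ j = (\<Sum>k\<in>UNIV. (\<Sum>t\<in>T. A $ i $ t * b k t) * B $ k $ j)"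
      by (simp add: matrix_matrix_mult_def flip: b)
    also have "\<dots> = (\<Sum>t\<in>T. A $ i $ t * C t j)"
      unfolding C_def sum_distrib_left sum_distrib_right mult.assoc by (rule sum.swap)
    finally show ?thesis .
  qed
  obtain c where c: "\<exists>j\<in>S. c j \<noteq> 0" "\<forall>t\<in>T. (\<Sum>j\<in>S. C t j * c j) = 0"
    using homogeneous_system_nontrivial_solution[of T S C] less T S by auto
  have "(\<Sum>j\<in>S. (A ** B) $ i $ j * c j) = 0" for i
  proof -
    have "(\<Sum>j\<in>S. (A ** B) $ i $ j * c j) = (\<Sum>t\<in>T. A $ i $ t * (\<Sum>j\<in>S. C t j * c j))"
      unfolding AB sum_distrib_left sum_distrib_right mult.assoc by (rule sum.swap)
    with c(2) show ?thesis
      by simp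
  qed
  with S(1) c(1) show False
    by (auto simp: right_indep_columns_def)
qed

text \<open>Multiplication from the left preserves right-linear relations between columns, so
  independence in the product passes to \<open>B\<close>.\<close>

lemma right_rank_mult_le_right:
  fixes A :: "'a::division_ring^'n^'m" and B :: "'a^'k^'n"
  shows "right_rank (A ** B) \<le> right_rank B"
proof -
  obtain S where S: "right_indep_columns (A ** B) S" "right_rank (A ** B) = card S"
    by (rule right_rank_attained)
  have "right_indep_columns B S"
    unfolding right_indep_columns_def
  proof (intro allI impI)
    fix c
    assume c: "\<forall>i. (\<Sum>j\<in>S. B $ i $ j * c j) = 0"
    have "(\<Sum>j\<in>S. (A ** B) $ i $ j * c j) = (\<Sum>k\<in>UNIV. A $ i $ k * (\<Sum>j\<in>S. B $ k $ j * c j))" for i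
      unfolding matrix_matrix_mult_def vec_lambda_beta sum_distrib_left sum_distrib_right mult.assoc
      by (rule sum.swap)
    with c S(1) show "\<forall>j\<in>S. c j = 0"
      by (simp add: right_indep_columns_def)
  qed
  with S(2) show ?thesis
    using right_rank_ge by metis
qed

text \<open>\<open>A\<close> is a product with \<open>X\<close> as a factor. For a reflexive inverse
  the roles of \<open>A\<close> and \<open>X\<close> can be exchanged, which gives equality.\<close>

lemma right_rank_generalized_inverse_ge:
  fixes A :: "'a::division_ring^'n^'m"
  assumes "A ** X ** A = A"
  shows "right_rank A \<le> right_rank X"
  by (metis assms order_trans right_rank_mult_le_left right_rank_mult_le_right)

lemma rank_reflexive_generalized_inverse:
  fixes A :: "'a::field^'n^'m"
  assumes "A ** X ** A = A" "X ** A ** X = X"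
  shows "rank X = rank A"
  using assms by (intro antisym rank_generalized_inverse_ge)

lemma right_rank_reflexive_generalized_inverse:
  fixes A :: "'a::division_ring^'n^'m"
  assumes "A ** X ** A = A" "X ** A ** X = X"
  shows "right_rank X = right_rank A"
  using assms by (intro antisym right_rank_generalized_inverse_ge)

theorem mainTheorem4:
  shows
    "(\<forall>(DL :: real^'n^'m \<Rightarrow> real^'m^'m) (DR :: real^'n^'m \<Rightarrow> real^'n^'n)
         (A :: real^'n^'m) (D :: real^'m^'m) (E :: real^'n^'n).
        general_diagonal_scale_functions DL DR \<and> no_zero_element A \<and>
        diagonal_matrix D \<and> invertible D \<and> diagonal_matrix E \<and> invertible E \<longrightarrow>
          A ** uc_inverse DL DR A ** A = A \<and>
          uc_inverse DL DR A ** A ** uc_inverse DL DR A = uc_inverse DL DR A \<and>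
          uc_inverse DL DR (D ** A ** E) = matrix_inv E ** uc_inverse DL DR A ** matrix_inv D \<and>
          rank (uc_inverse DL DR A) = rank A) \<and>
     (\<forall>(DL :: complex^'n^'m \<Rightarrow> complex^'m^'m) (DR :: complex^'n^'m \<Rightarrow> complex^'n^'n)
         (A :: complex^'n^'m) (D :: complex^'m^'m) (E :: complex^'n^'n).
        general_diagonal_scale_functions DL DR \<and> no_zero_element A \<and>
        diagonal_matrix D \<and> invertible D \<and> diagonal_matrix E \<and> invertible E \<longrightarrow>
          A ** uc_inverse DL DR A ** A = A \<and>
          uc_inverse DL DR A ** A ** uc_inverse DL DR A = uc_inverse DL DR A \<and>
          uc_inverse DL DR (D ** A ** E) = matrix_inv E ** uc_inverse DL DR A ** matrix_inv D \<and>
          rank (uc_inverse DL DR A) = rank A) \<and>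
     (\<forall>(DL :: quat^'n^'m \<Rightarrow> quat^'m^'m) (DR :: quat^'n^'m \<Rightarrow> quat^'n^'n)
         (A :: quat^'n^'m) (D :: quat^'m^'m) (E :: quat^'n^'n).
        general_diagonal_scale_functions DL DR \<and> no_zero_element A \<and>
        diagonal_matrix D \<and> invertible D \<and> diagonal_matrix E \<and> invertible E \<longrightarrow>
          A ** uc_inverse DL DR A ** A = A \<and>
          uc_inverse DL DR A ** A ** uc_inverse DL DR A = uc_inverse DL DR A \<and>
          uc_inverse DL DR (D ** A ** E) = matrix_inv E ** uc_inverse DL DR A ** matrix_inv D \<and>
          right_rank (uc_inverse DL DR A) = right_rank A)"
  using uc_inverse_reflexive uc_inverse_diagonal
    rank_reflexive_generalized_inverse[OF uc_inverse_reflexive]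
    right_rank_reflexive_generalized_inverse[OF uc_inverse_reflexive]
  by (intro conjI allI impI; elim conjE) blast+

end
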